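(* Let $\mathcal{F}$ be a regular thin family and $(x_s)_{s\in\mathcal{F}}$ be an $\mathcal{F}$-sequence in a topological space $(X,\mathcal{T})$. Then for every $M\in[\mathbb{N}]^\infty$ such that $\overline{\{x_s:s\in\mathcal{F}\upharpoonright M\}}$ is a compact metrizable subspace of $(X,\mathcal{T})$ there exists $L\in[M]^\infty$ such that $(x_s)_{s\in\mathcal{F}\upharpoonright L}$ is subordinated (with respect to $(X,\mathcal{T})$).
   Context: $\mathbb{N}=\{1,2,\dots\}$. For $M\subseteq\mathbb{N}$, $[M]^{<\infty}$ and $[M]^\infty$ denote the sets of finite, respectively infinite, subsets of $M$. $t\sqsubseteq s$ means that $t$ is an initial segment of $s$. For $\mathcal{F}\subseteq[\mathbb{N}]^{<\infty}$, $\mathcal{F}\upharpoonright M=\mathcal{F}\cap[M]^{<\infty}$ and $\widehat{\mathcal{F}}=\{t\in[\mathbb{N}]^{<\infty}:\exists s\in\mathcal{F},\ t\sqsubseteq s\}$. A nonempty family $\mathcal{R}\subseteq[\mathbb{N}]^{<\infty}$ is regular if it is hereditary (closed under subsets), spreading (if $\{n_1<\dots<n_k\}\in\mathcal{R}$, $m_1<\dots<m_k$ and $n_i\leq m_i$ for all $i$, then $\{m_1,\dots,m_k\}\in\mathcal{R}$) and compact (the set of characteristic functions of its members is closed in $\{0,1\}^{\mathbb{N}}$). $\mathcal{F}$ is thin if no element of $\mathcal{F}$ is a proper initial segment of another one. $\mathcal{F}$ is regular thin if it is thin and $\widehat{\mathcal{F}}$ is regular. An $\mathcal{F}$-sequence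 in $X$ is a map $\mathcal{F}\to X$, written $(x_s)_{s\in\mathcal{F}}$, and $(x_s)_{s\in\mathcal{F}\upharpoonright M}$ denotes its restriction to $\mathcal{F}\upharpoonright M$. Families of finite subsets of $\mathbb{N}$ are topologized as subspaces of $\{0,1\}^{\mathbb{N}}$ (product topology) by identifying sets with characteristic functions. $(x_s)_{s\in\mathcal{F}\upharpoonright M}$ is subordinated (with respect to $(X,\mathcal{T})$) if there exists a continuous map $\widehat{\varphi}:\widehat{\mathcal{F}}\upharpoonright M\to(X,\mathcal{T})$ with $\widehat{\varphi}(s)=x_s$ for every $s\in\mathcal{F}\upharpoonright M$. The closure is taken in $(X,\mathcal{T})$. *)

theory Defs
  imports "HOL-Analysis.Analysis"
begin

text \<open>
  The set of natural numbers starts at 1. Following the library, finite subsets of a set \<open>M\<close>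
  form \<^term>\<open>Fpow M\<close>.
\<close>

abbreviation Pos :: "nat set" where
  "Pos \<equiv> {1..}"

definition initial_segment :: "nat set \<Rightarrow> nat set \<Rightarrow> bool" (infix "\<sqsubseteq>" 50) where
  "t \<sqsubseteq> s \<longleftrightarrow> t \<subseteq> s \<and> (\<forall>a\<in>t. \<forall>b\<in>s - t. a < b)"

definition restr_family :: "nat set set \<Rightarrow> nat set \<Rightarrow> nat set set" (infixl "\<restriction>" 70) where
  "F \<restriction> M = F \<inter> Fpow M"

definition hat :: "nat set set \<Rightarrow> nat set set" where
  "hat F = {t \<in> Fpow Pos. \<exists>s\<in>F. t \<sqsubseteq> s}"

text \<open>
  The space \<open>{0,1}\<^sup>\<nat>\<close>, with \<open>{0,1}\<close> rendered as \<^typ>\<open>bool\<close>. The points of a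
  \<^const>\<open>product_topology\<close> over the index set \<^const>\<open>Pos\<close> are functions that are
  \<^const>\<open>undefined\<close> outside it, hence the restricted abstraction in \<open>char_fun\<close>.
\<close>

definition cantor_top :: "(nat \<Rightarrow> bool) topology" where
  "cantor_top = product_topology (\<lambda>_. discrete_topology UNIV) Pos"

definition char_fun :: "nat set \<Rightarrow> nat \<Rightarrow> bool" where
  "char_fun s = (\<lambda>n\<in>Pos. n \<in> s)"

text \<open>
  For \<open>G \<subseteq> Fpow Pos\<close> the map \<open>char_fun\<close> is injective on \<open>G\<close>, so pulling back along it
  yields the subspace topology of \<open>G\<close> under identification of sets with characteristic functions.
\<close>

definition family_top :: "nat set set \<Rightarrow> nat set topology" where
  "family_top G = pullback_topology G char_fun cantor_top"

definition hereditary :: "nat set set \<Rightarrow> bool" where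
  "hereditary R \<longleftrightarrow> (\<forall>s\<in>R. \<forall>t. t \<subseteq> s \<longrightarrow> t \<in> R)"

text \<open>The strictly sorted lists are the increasing enumerations of the finite sets.\<close>

definition spreading :: "nat set set \<Rightarrow> bool" where
  "spreading R \<longleftrightarrow>
    (\<forall>ns ms. sorted_wrt (<) ns \<and> sorted_wrt (<) ms \<and> list_all2 (\<le>) ns ms \<and> set ns \<in> R
      \<longrightarrow> set ms \<in> R)"

definition compact_family :: "nat set set \<Rightarrow> bool" where
  "compact_family R \<longleftrightarrow> closedin cantor_top (char_fun ` R)"

definition regular_family :: "nat set set \<Rightarrow> bool" where
  "regular_family R \<longleftrightarrow>
    R \<noteq> {} \<and> R \<subseteq> Fpow Pos \<and> hereditary R \<and> spreading R \<and> compact_family R"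

definition thin :: "nat set set \<Rightarrow> bool" where
  "thin F \<longleftrightarrow> (\<forall>s\<in>F. \<forall>t\<in>F. \<not> (t \<sqsubseteq> s \<and> t \<noteq> s))"

definition regular_thin :: "nat set set \<Rightarrow> bool" where
  "regular_thin F \<longleftrightarrow> F \<subseteq> Fpow Pos \<and> thin F \<and> regular_family (hat F)"

text \<open>
  \<open>subordinated T F M x\<close>: the restriction of the \<open>F\<close>-sequence \<open>x\<close> to \<open>F \<restriction> M\<close> is subordinated
  with respect to the topological space \<open>T\<close>.
\<close>

definition subordinated ::
    "'a topology \<Rightarrow> nat set set \<Rightarrow> nat set \<Rightarrow> (nat set \<Rightarrow> 'a) \<Rightarrow> bool" where
  "subordinated T F M x \<longleftrightarrow>
    (\<exists>\<phi>. continuous_map (family_top (hat F \<restriction> M)) T \<phi> \<and> (\<forall>s \<in> F \<restriction> M. \<phi> s = x s))"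

end

theory Submission
  imports Defs
begin

text \<open>
  In a family of finite sets, a sequence converges to \<open>u\<close> exactly when its terms
  eventually are end-extensions of \<open>u\<close> whose new elements tend to infinity. So a map \<open>\<phi>\<close>
  is continuous at \<open>u\<close> as soon as \<open>\<phi> v\<close> is close to \<open>\<phi> u\<close> for all
  end-extensions \<open>v\<close> of \<open>u\<close> with large new elements
  (\<open>family_top_neighbourhood\<close>). The task is to choose \<open>L\<close> so sparse that such a
  \<open>\<phi>\<close> exists with the prescribed values on \<open>F \<restriction> L\<close>.

  Compactness of \<open>hat F\<close> rules out infinite chains of proper end-extensions, since their union
  would be an infinite set in the closure (\<open>compact_family_wf\<close>). This permits well-founded
  induction on \<open>t \<in> hat F \<restriction> M\<close>, starting from the maximal sets, for the claim: every
  infinite set can be thinned out so that a suitable \<open>\<phi>\<close> exists on the end-extensions of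
  \<open>t\<close> (\<open>limit_extension_exists\<close>). If \<open>t \<in> F\<close>, then thinness leaves \<open>t\<close> as its only
  end-extension. Otherwise the proper end-extensions of \<open>t\<close> are split by their first new
  element \<open>m\<close>, and the induction hypothesis gives a map \<open>\<Phi> m\<close> on each piece. One infinite set
  serves all pieces simultaneously by diagonalization (\<open>fusion\<close>), where moreover
  the values of \<open>\<Phi> m\<close> can be kept within \<open>1 / (m + 1)\<close> of the value at \<open>t \<union> {m}\<close>. These
  apex values lie in a compact metric space, so along a further infinite subset they
  converge, and their limit is a continuous choice of \<open>\<phi> t\<close>
  (\<open>limit_extension_step\<close>). The theorem is the case \<open>t = {}\<close>.
\<close>

section \<open>Initial segments and end-extensions\<close>

lemma initial_segment_trans: "r \<sqsubseteq> s \<Longrightarrow> s \<sqsubseteq> t \<Longrightarrow> r \<sqsubseteq> t"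
  unfolding initial_segment_def by blast

definition end_extensions :: "nat set set \<Rightarrow> nat set \<Rightarrow> nat set \<Rightarrow> nat set set" where
  "end_extensions G t A = {v \<in> G. t \<sqsubseteq> v \<and> v - t \<subseteq> A}"

lemma end_extensions_mono: "A \<subseteq> B \<Longrightarrow> end_extensions G t A \<subseteq> end_extensions G t B"
  unfolding end_extensions_def by blast

lemma end_extensions_refl: "t \<in> G \<Longrightarrow> t \<in> end_extensions G t A"
  unfolding end_extensions_def initial_segment_def by blast

text \<open>This sorts the proper end-extensions of \<open>t\<close> by their first new element, which is how
  the domain splits into pieces in the induction step. The piece for \<open>m\<close> only involves
  elements of \<open>A\<close> above \<open>m\<close>, so \<open>A\<close> may be thinned out after \<open>m\<close> has been chosen.\<close>

lemma end_extension_next: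
  assumes v: "v \<in> end_extensions G t A" "v \<noteq> t" and "finite v"
  shows "Min (v - t) \<in> A" "\<forall>a\<in>t. a < Min (v - t)"
    "v \<in> end_extensions G (insert (Min (v - t)) t) (A \<inter> {Min (v - t)<..})"
proof -
  let ?m = "Min (v - t)"
  have fin: "finite (v - t)" and ne: "v - t \<noteq> {}"
    using assms by (auto simp: end_extensions_def initial_segment_def)
  have m: "?m \<in> v - t" using fin ne by (rule Min_in)
  have le: "?m \<le> b" if "b \<in> v - t" for b
    using fin that by (rule Min_le)
  have lt: "?m < b" if "b \<in> v - insert ?m t" for b
    using le[of b] that by force
  show "?m \<in> A" "\<forall>a\<in>t. a < ?m"
    using m v by (auto simp: end_extensions_def initial_segment_def)
  then show "v \<in> end_extensions G (insert ?m t) (A \<inter> {?m<..})"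
    using v m lt by (auto simp: end_extensions_def initial_segment_def)
qed

text \<open>All end-extensions of \<open>u\<close> lie in the same piece as \<open>u\<close>: continuity at \<open>u \<noteq> t\<close> is
  therefore inherited from a single piece.\<close>

lemma Min_Diff_end_extension:
  assumes u: "u \<in> end_extensions G t A" "u \<noteq> t" and v: "u \<sqsubseteq> v" "finite v"
  shows "Min (v - t) = Min (u - t)"
proof -
  have fin: "finite (u - t)" and ne: "u - t \<noteq> {}" and tu: "t \<subseteq> u"
    using assms rev_finite_subset[of v "u - t"] by (auto simp: end_extensions_def initial_segment_def)
  have m: "Min (u - t) \<in> u - t" using fin ne by (rule Min_in)
  show ?thesis
  proof (rule Min_eqI)
    fix b assume "b \<in> v - t"
    then show "Min (u - t) \<le> b"
      using v m Min_le[OF fin, of b] by (cases "b \<in> u") (auto simp: initial_segment_def intro: less_imp_le)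
  qed (use v m in \<open>auto simp: initial_segment_def\<close>)
qed

section \<open>Fusion\<close>

text \<open>The diagonal argument: take \<open>m\<^sub>0\<close>, thin out the rest of \<open>M\<close> to suit \<open>m\<^sub>0\<close>, take \<open>m\<^sub>1\<close> from what
  remains, and so on. The elements chosen after \<open>m\<^sub>i\<close> all come from the set that suits
  \<open>m\<^sub>i\<close>, and \<open>R\<close> passes to subsets.\<close>

lemma fusion:
  fixes M :: "nat set"
  assumes "infinite M"
    and step: "\<And>m B. m \<in> M \<Longrightarrow> B \<subseteq> M \<Longrightarrow> infinite B \<Longrightarrow> \<exists>A\<subseteq>B. infinite A \<and> R m A"
    and anti: "\<And>m A B. R m A \<Longrightarrow> B \<subseteq> A \<Longrightarrow> R m B"
  shows "\<exists>L\<subseteq>M. infinite L \<and> (\<forall>m\<in>L. R m (L \<inter> {m<..}))"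
proof -
  \<comment> \<open>A stage of the construction: the chosen element and the set of candidates for later ones.\<close>
  define P where "P = (\<lambda>(m, A). m \<in> M \<and> A \<subseteq> M \<inter> {m<..} \<and> infinite A \<and> R m A)"
  have choose: "\<exists>p. P p \<and> fst p \<in> B \<and> snd p \<subseteq> B" if B: "B \<subseteq> M" "infinite B" for B
  proof -
    obtain m where m: "m \<in> B" using B(2) by fastforce
    have "B \<inter> {m<..} = B - {..m}" by auto
    then have "infinite (B \<inter> {m<..})" using B(2) by simp
    with step[of m "B \<inter> {m<..}"] m B(1) obtain A
      where "A \<subseteq> B \<inter> {m<..}" "infinite A" "R m A" by blast
    then show ?thesis
      using m B(1) by (intro exI[of _ "(m, A)"]) (auto simp: P_def)
  qed
  have "\<exists>f. \<forall>n. P (f n) \<and> (fst (f (Suc n)) \<in> snd (f n) \<and> snd (f (Suc n)) \<subseteq> snd (f n))"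
  proof (rule dependent_nat_choice)
    show "\<exists>p. P p" using choose[of M] assms(1) by blast
    show "\<exists>q. P q \<and> (fst q \<in> snd p \<and> snd q \<subseteq> snd p)" if "P p" for p
      using choose[of "snd p"] that by (auto simp: P_def split: prod.splits)
  qed
  then obtain f where f: "\<And>n. P (f n)" "\<And>n. fst (f (Suc n)) \<in> snd (f n)"
      "\<And>n. snd (f (Suc n)) \<subseteq> snd (f n)" by blast
  define m where "m = fst \<circ> f"
  define A where "A = snd \<circ> f"
  have mA: "m n \<in> M" "A n \<subseteq> {m n<..}" "R (m n) (A n)" "m (Suc n) \<in> A n" for n
    using f(1)[of n] f(2)[of n] by (auto simp: P_def m_def A_def split: prod.splits)
  have A_anti: "A j \<subseteq> A i" if "i \<le> j" for i j
    using lift_Suc_antimono_le[of A, OF _ that] f(3) by (simp add: A_def)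
  have smono: "strict_mono m"
    using mA(2,4) by (auto simp: strict_mono_Suc_iff)
  have tail: "m j \<in> A i" if "i < j" for i j
    using mA(4)[of "j - 1"] A_anti[of i "j - 1"] that by (cases j) auto
  have "R (m i) (range m \<inter> {m i<..})" for i
    using tail smono by (intro anti[OF mA(3)]) (auto simp: strict_mono_less)
  moreover have "infinite (range m)"
    using smono by (intro range_inj_infinite strict_mono_imp_inj_on)
  ultimately show ?thesis
    using mA(1) by (intro exI[of _ "range m"]) auto
qed

section \<open>Extending over the initial segments\<close>

text \<open>The family \<open>G\<close> plays the role of \<open>hat F \<restriction> M\<close>, and \<open>S\<close> that of \<open>F \<restriction> M\<close>. The limit condition is
  continuity of \<open>\<phi>\<close> on the end-extensions of \<open>t\<close>, in combinatorial form.\<close>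

definition (in Metric_space) limit_extension ::
    "nat set set \<Rightarrow> nat set set \<Rightarrow> (nat set \<Rightarrow> 'a) \<Rightarrow> nat set \<Rightarrow> nat set \<Rightarrow> (nat set \<Rightarrow> 'a) \<Rightarrow> bool" where
  "limit_extension G S x t A \<phi> \<longleftrightarrow>
    (\<forall>s \<in> end_extensions G t A \<inter> S. \<phi> s = x s) \<and>
    (\<forall>u \<in> end_extensions G t A. \<phi> u \<in> M \<and> (\<forall>e>0. \<exists>N. \<forall>v \<in> end_extensions G u (A \<inter> {N<..}). d (\<phi> u) (\<phi> v) < e))"

lemma (in Metric_space) limit_extension_antimono:
  assumes "limit_extension G S x t A \<phi>" "B \<subseteq> A"
  shows "limit_extension G S x t B \<phi>"
proof -
  have "end_extensions G u (B \<inter> {N<..}) \<subseteq> end_extensions G u (A \<inter> {N<..})" for u N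
    using assms(2) by (intro end_extensions_mono) auto
  then show ?thesis
    using assms(1) end_extensions_mono[OF assms(2), of G t]
    unfolding limit_extension_def by (meson Int_iff subsetD)
qed

text \<open>By continuity at the apex \<open>t\<close>, dropping finitely many elements of \<open>A\<close> makes all values close
  to \<open>\<phi> t\<close>.\<close>

lemma (in Metric_space) limit_extension_near_apex:
  assumes "limit_extension G S x t A \<phi>" "t \<in> G" "infinite A" "e > 0"
  shows "\<exists>B\<subseteq>A. infinite B \<and> limit_extension G S x t B \<phi> \<and> (\<forall>v \<in> end_extensions G t B. d (\<phi> t) (\<phi> v) < e)"
proof -
  obtain N where N: "\<forall>v \<in> end_extensions G t (A \<inter> {N<..}). d (\<phi> t) (\<phi> v) < e"
    using assms end_extensions_refl[of t G A] unfolding limit_extension_def by blast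
  have "A \<inter> {N<..} = A - {..N}" by auto
  then have "infinite (A \<inter> {N<..})" using assms(3) by simp
  then show ?thesis
    using N limit_extension_antimono[OF assms(1)] by (intro exI[of _ "A \<inter> {N<..}"]) auto
qed

text \<open>The induction step. Each piece carries its own map by the induction hypothesis; the maps are
  glued along one common infinite set, and the only new point is \<open>t\<close> itself. Its value is a
  limit of the apex values \<open>p m\<close> of the pieces. It controls whole pieces, not just their
  apices, because the piece for \<open>m\<close> has been shrunk into the \<open>1 / (m + 1)\<close>-ball around \<open>p m\<close>.\<close>

lemma (in Metric_space) limit_extension_step:
  assumes cpt: "compact_space mtopology" and ne: "M \<noteq> {}"
    and fin: "\<And>v. v \<in> G \<Longrightarrow> finite v"
    and closed: "\<And>u v. v \<in> G \<Longrightarrow> u \<sqsubseteq> v \<Longrightarrow> u \<in> G"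
    and t: "t \<in> G" "t \<notin> S" and "infinite A0"
    and IH: "\<And>m B. insert m t \<in> G \<Longrightarrow> \<forall>a\<in>t. a < m \<Longrightarrow> infinite B \<Longrightarrow>
      \<exists>A\<subseteq>B. infinite A \<and> (\<exists>\<phi>. limit_extension G S x (insert m t) A \<phi>)"
  shows "\<exists>A\<subseteq>A0. infinite A \<and> (\<exists>\<phi>. limit_extension G S x t A \<phi>)"
proof -
  \<comment> \<open>The radius depends on \<open>m\<close> itself and not on its index, so passing to subsets keeps it.\<close>
  define R where "R = (\<lambda>m A. \<exists>\<phi> p. p \<in> M \<and> limit_extension G S x (insert m t) A \<phi> \<and>
    (\<forall>v \<in> end_extensions G (insert m t) A. d p (\<phi> v) < 1 / (real m + 1)))"
  define A1 where "A1 = A0 \<inter> {m. \<forall>a\<in>t. a < m}"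
  have "A0 \<subseteq> A1 \<union> (\<Union>a\<in>t. {..a})"
    by (auto simp: A1_def not_less)
  moreover have "finite (\<Union>a\<in>t. {..a})"
    using fin[OF t(1)] by simp
  ultimately have "infinite A1"
    using \<open>infinite A0\<close> by (meson finite_Un finite_subset)
  have "\<exists>L\<subseteq>A1. infinite L \<and> (\<forall>m\<in>L. R m (L \<inter> {m<..}))"
  proof (rule fusion[OF \<open>infinite A1\<close>])
    fix m and B :: "nat set" assume m: "m \<in> A1" and "infinite B"
    show "\<exists>A\<subseteq>B. infinite A \<and> R m A"
    proof (cases "insert m t \<in> G")
      case True
      then obtain A \<phi> where A: "A \<subseteq> B" "infinite A" "limit_extension G S x (insert m t) A \<phi>"
        using IH[of m B] m \<open>infinite B\<close> by (auto simp: A1_def)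
      have "\<phi> (insert m t) \<in> M"
        using A(3) end_extensions_refl[OF True] by (auto simp: limit_extension_def)
      then show ?thesis
        using limit_extension_near_apex[OF A(3) True A(2), of "1 / (real m + 1)"] A(1)
        unfolding R_def by (meson add_nonneg_pos of_nat_0_le_iff order_trans zero_less_divide_1_iff zero_less_one)
    next
      \<comment> \<open>An empty piece: any point of \<open>M\<close> may serve as its apex value.\<close>
      case False
      then have "end_extensions G (insert m t) B = {}"
        using closed by (auto simp: end_extensions_def)
      then have "R m B"
        using ne unfolding R_def limit_extension_def by auto
      then show ?thesis using \<open>infinite B\<close> by blast
    qed
  next
    fix m A B assume "R m A" "B \<subseteq> A"
    then show "R m B"
      using limit_extension_antimono end_extensions_mono[OF \<open>B \<subseteq> A\<close>] unfolding R_def by (meson subsetD)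
  qed
  then obtain L where L: "L \<subseteq> A1" "infinite L" "\<And>m. m \<in> L \<Longrightarrow> R m (L \<inter> {m<..})" by blast
  then obtain \<Phi> p where p: "\<And>m. m \<in> L \<Longrightarrow> p m \<in> M"
      and ext: "\<And>m. m \<in> L \<Longrightarrow> limit_extension G S x (insert m t) (L \<inter> {m<..}) (\<Phi> m)"
      and near: "\<And>m v. m \<in> L \<Longrightarrow> v \<in> end_extensions G (insert m t) (L \<inter> {m<..}) \<Longrightarrow> d (p m) (\<Phi> m v) < 1 / (real m + 1)"
    unfolding R_def by metis
  have enum: "strict_mono (enumerate L)" "\<And>n. enumerate L n \<in> L"
    using L(2) strict_mono_enumerate enumerate_in_set by blast+
  then obtain q r where q: "q \<in> M" "strict_mono r"
      "limitin mtopology ((p \<circ> enumerate L) \<circ> r) q sequentially"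
    using cpt p unfolding compact_space_def compactin_sequentially
    by (metis comp_apply image_subset_iff topspace_mtopology)
  \<comment> \<open>Keep only those elements of \<open>L\<close> along which the apex values converge to \<open>q\<close>.\<close>
  define m where "m = enumerate L \<circ> r"
  have m: "strict_mono m" "\<And>n. m n \<in> L"
    using enum q(2) by (auto simp: m_def strict_mono_def)
  define A where "A = range m"
  have A: "A \<subseteq> L" "infinite A"
    using m by (auto simp: A_def intro!: range_inj_infinite strict_mono_imp_inj_on)
  define \<phi> where "\<phi> v = (if v = t then q else \<Phi> (Min (v - t)) v)" for v
  have piece: "limit_extension G S x (insert k t) (A \<inter> {k<..}) (\<Phi> k)" if "k \<in> A" for k
    using that A(1) by (intro limit_extension_antimono[OF ext[of k]]) auto
  have tail: "\<exists>N. \<forall>v \<in> end_extensions G u (A \<inter> {N<..}). d (\<phi> u) (\<phi> v) < e"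
    if u: "u \<in> end_extensions G t A" and e: "e > 0" for u e
  proof (cases "u = t")
    case True
    have "\<forall>\<^sub>F n in sequentially. d (p (m n)) q < e / 2"
      using q(3) e unfolding limitin_metric
      by (auto simp: m_def elim!: allE[of _ "e/2"] eventually_mono)
    moreover have "(\<lambda>n. 1 / (real n + 1)) \<longlonglongrightarrow> 0"
      using LIMSEQ_inverse_real_of_nat by (simp add: inverse_eq_divide add.commute)
    then have "\<forall>\<^sub>F n in sequentially. 1 / (real n + 1) < e / 2"
      using e by (intro order_tendstoD) auto
    ultimately have "\<forall>\<^sub>F n in sequentially. d (p (m n)) q < e / 2 \<and> 1 / (real n + 1) < e / 2"
      by (rule eventually_conj)
    then obtain n0 where n0: "\<And>n. n \<ge> n0 \<Longrightarrow> d (p (m n)) q < e / 2 \<and> 1 / (real n + 1) < e / 2"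
      unfolding eventually_sequentially by blast
    have "d (\<phi> t) (\<phi> v) < e" if v: "v \<in> end_extensions G t (A \<inter> {m n0<..})" for v
    proof (cases "v = t")
      case True
      then show ?thesis using e q(1) by (simp add: \<phi>_def)
    next
      case False
      let ?k = "Min (v - t)"
      have "finite v" using v fin by (auto simp: end_extensions_def)
      note nxt = end_extension_next[OF v False this]
      then obtain n where n: "?k = m n" and "m n0 < m n" by (auto simp: A_def)
      then have "n0 \<le> n" using m(1) by (simp add: strict_mono_less)
      have "n \<le> m n" using m(1) by (rule strict_mono_imp_increasing)
      have vk: "v \<in> end_extensions G (insert ?k t) (L \<inter> {?k<..})"
        using nxt(3) end_extensions_mono[of "A \<inter> {m n0<..} \<inter> {?k<..}" "L \<inter> {?k<..}" G] A(1) by auto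
      have "?k \<in> L" using nxt(1) A(1) by auto
      have "v \<in> end_extensions G (insert ?k t) (A \<inter> {?k<..})"
        using nxt(3) end_extensions_mono[of "A \<inter> {m n0<..} \<inter> {?k<..}" "A \<inter> {?k<..}" G] by auto
      then have "\<Phi> ?k v \<in> M"
        using piece[of ?k] nxt(1) unfolding limit_extension_def by blast
      have "d (\<phi> t) (\<phi> v) = d q (\<Phi> ?k v)" using False by (simp add: \<phi>_def)
      also have "\<dots> \<le> d q (p ?k) + d (p ?k) (\<Phi> ?k v)"
        using q(1) p \<open>?k \<in> L\<close> \<open>\<Phi> ?k v \<in> M\<close> by (intro triangle) auto
      also have "d q (p ?k) < e / 2"
        using n0[OF \<open>n0 \<le> n\<close>] n by (simp add: commute)
      also have "d (p ?k) (\<Phi> ?k v) < 1 / (real ?k + 1)"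
        using near[OF \<open>?k \<in> L\<close> vk] .
      also have "1 / (real ?k + 1) \<le> 1 / (real n + 1)"
        using n \<open>n \<le> m n\<close> by (simp add: frac_le)
      also have "\<dots> < e / 2" using n0[OF \<open>n0 \<le> n\<close>] by simp
      finally show ?thesis by simp
    qed
    then show ?thesis using True by blast
  next
    case False
    let ?k = "Min (u - t)"
    have "finite u" using u fin by (auto simp: end_extensions_def)
    note nxt = end_extension_next[OF u False this]
    obtain N where N: "\<forall>v \<in> end_extensions G u (A \<inter> {?k<..} \<inter> {N<..}). d (\<Phi> ?k u) (\<Phi> ?k v) < e"
      using piece[OF nxt(1)] nxt(3) e unfolding limit_extension_def by blast
    have "d (\<phi> u) (\<phi> v) < e" if v: "v \<in> end_extensions G u (A \<inter> {N<..})" for v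
    proof -
      have "u \<sqsubseteq> v" "finite v" using v fin by (auto simp: end_extensions_def)
      then have Mv: "Min (v - t) = ?k" by (rule Min_Diff_end_extension[OF u False])
      have "?k \<in> u"
        using nxt(3) by (auto simp: end_extensions_def initial_segment_def)
      then have "v - u \<subseteq> {?k<..}"
        using \<open>u \<sqsubseteq> v\<close> by (auto simp: initial_segment_def)
      then have "v \<in> end_extensions G u (A \<inter> {?k<..} \<inter> {N<..})"
        using v by (auto simp: end_extensions_def)
      moreover have "v \<noteq> t"
        using \<open>u \<sqsubseteq> v\<close> u False by (auto simp: end_extensions_def initial_segment_def)
      ultimately show ?thesis using N False Mv by (simp add: \<phi>_def)
    qed
    then show ?thesis by blast
  qed
  have vals: "\<phi> u \<in> M \<and> (u \<in> S \<longrightarrow> \<phi> u = x u)" if u: "u \<in> end_extensions G t A" for u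
  proof (cases "u = t")
    case True
    then show ?thesis using q(1) t(2) by (simp add: \<phi>_def)
  next
    case False
    have "finite u" using u fin by (auto simp: end_extensions_def)
    note nxt = end_extension_next[OF u False this]
    show ?thesis
      using piece[OF nxt(1)] nxt(3) False unfolding limit_extension_def by (auto simp: \<phi>_def)
  qed
  have "limit_extension G S x t A \<phi>"
    using tail vals unfolding limit_extension_def by blast
  then show ?thesis
    using A L(1) by (intro exI[of _ A]) (auto simp: A1_def)
qed

text \<open>The relation puts end-extensions below the sets they extend, so the induction runs from
  longer sets to shorter ones. A set \<open>t \<in> S\<close> is a leaf: maximality leaves no other end-extension,
  and the constant map \<open>x t\<close> works there.\<close>

lemma (in Metric_space) limit_extension_exists:
  assumes cpt: "compact_space mtopology" and ne: "M \<noteq> {}"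
    and fin: "\<And>v. v \<in> G \<Longrightarrow> finite v"
    and closed: "\<And>u v. v \<in> G \<Longrightarrow> u \<sqsubseteq> v \<Longrightarrow> u \<in> G"
    and wf: "wf {(v, u). u \<in> G \<and> v \<in> G \<and> u \<sqsubseteq> v \<and> u \<noteq> v}"
    and maxi: "\<And>s v. s \<in> S \<Longrightarrow> v \<in> G \<Longrightarrow> s \<sqsubseteq> v \<Longrightarrow> v = s"
    and x: "\<And>s. s \<in> S \<Longrightarrow> x s \<in> M"
    and "t \<in> G" "infinite B"
  shows "\<exists>A\<subseteq>B. infinite A \<and> (\<exists>\<phi>. limit_extension G S x t A \<phi>)"
  using wf \<open>t \<in> G\<close> \<open>infinite B\<close>
proof (induction t arbitrary: B rule: wf_induct_rule)
  case (less t)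
  show ?case
  proof (cases "t \<in> S")
    case True
    then have "v = t" if "v \<in> end_extensions G t A" for v A
      using that maxi by (auto simp: end_extensions_def)
    then have "limit_extension G S x t B (\<lambda>_. x t)"
      using x[OF True] unfolding limit_extension_def by auto
    then show ?thesis using less.prems by blast
  next
    case False
    show ?thesis
    proof (rule limit_extension_step[OF cpt ne fin closed less.prems(1) False less.prems(2)])
      fix m B assume m: "insert m t \<in> G" "\<forall>a\<in>t. a < m" and B: "infinite (B :: nat set)"
      then have "t \<sqsubseteq> insert m t" "t \<noteq> insert m t"
        by (auto simp: initial_segment_def)
      then show "\<exists>A\<subseteq>B. infinite A \<and> (\<exists>\<phi>. limit_extension G S x (insert m t) A \<phi>)"
        using less.IH[of "insert m t" B] less.prems m B by auto
    qed auto
  qed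
qed

section \<open>The topology of a family of finite sets\<close>

lemma char_fun_topspace: "char_fun s \<in> topspace cantor_top"
  by (auto simp: char_fun_def cantor_top_def)

text \<open>An infinite chain of proper end-extensions converges pointwise to its union. That union would
  belong to the closed family \<open>G\<close>, although it is infinite.\<close>

lemma compact_family_wf:
  assumes "compact_family G" "G \<subseteq> Fpow Pos"
  shows "wf {(v, u). u \<in> G \<and> v \<in> G \<and> u \<sqsubseteq> v \<and> u \<noteq> v}"
  unfolding wf_iff_no_infinite_down_chain
proof clarify
  fix f assume "\<forall>i. (f (Suc i), f i) \<in> {(v, u). u \<in> G \<and> v \<in> G \<and> u \<sqsubseteq> v \<and> u \<noteq> v}"
  then have f: "\<And>i. f i \<in> G" "\<And>i. f i \<subset> f (Suc i)"
    by (auto simp: initial_segment_def)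
  have smono: "strict_mono f" using f(2) by (simp add: strict_mono_Suc_iff)
  define A where "A = (\<Union>i. f i)"
  have "limitin cantor_top (char_fun \<circ> f) (char_fun A) sequentially"
    unfolding cantor_top_def limitin_componentwise
  proof (intro conjI ballI)
    fix n :: nat assume n: "n \<in> Pos"
    have "\<forall>\<^sub>F i in sequentially. (n \<in> f i) = (n \<in> A)"
    proof (cases "n \<in> A")
      case True
      then obtain i where "n \<in> f i" by (auto simp: A_def)
      then have "n \<in> f j" if "i \<le> j" for j
        using that monoD[OF strict_mono_mono[OF smono]] by blast
      then show ?thesis using True unfolding eventually_sequentially by blast
    qed (auto simp: A_def)
    then show "limitin (discrete_topology UNIV) (\<lambda>i. (char_fun \<circ> f) i n) (char_fun A n) sequentially"
      using n by (intro limitin_eventually) (auto simp: char_fun_def)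
  qed (use char_fun_topspace in \<open>auto simp: char_fun_def cantor_top_def\<close>)
  then have "char_fun A \<in> char_fun ` G"
    using assms(1) f(1) unfolding compact_family_def
    by (intro limitin_closedin[of cantor_top _ _ sequentially]) auto
  then obtain g where g: "g \<in> G" "char_fun A = char_fun g" by blast
  have "A = g"
  proof (intro set_eqI)
    fix n
    have "A \<subseteq> Pos" "g \<subseteq> Pos" using f(1) g(1) assms(2) by (auto simp: A_def Fpow_def)
    moreover have "n \<in> A \<longleftrightarrow> n \<in> g" if "n \<in> Pos"
      using that fun_cong[OF g(2), of n] by (simp add: char_fun_def)
    ultimately show "n \<in> A \<longleftrightarrow> n \<in> g" by blast
  qed
  then have "finite A" using g(1) assms(2) by (auto simp: Fpow_def)
  moreover have "range f \<subseteq> Pow A" by (auto simp: A_def)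
  ultimately have "finite (range f)" by (meson finite_Pow_iff finite_subset)
  then show False using range_inj_infinite[OF strict_mono_imp_inj_on[OF smono]] by simp
qed

text \<open>Prescribing finitely many coordinates, up to a bound \<open>K\<close> beyond \<open>N\<close> and all of \<open>u\<close>, forces
  a set to begin with \<open>u\<close> and to continue above \<open>K\<close>. This translates the product topology into
  end-extensions.\<close>

lemma family_top_neighbourhood:
  assumes G: "G \<subseteq> Fpow Pos" and u: "u \<in> G"
  shows "\<exists>U. openin (family_top G) U \<and> u \<in> U \<and> U \<subseteq> end_extensions G u {N<..}"
proof -
  obtain K where K: "N \<le> K" "\<forall>a\<in>u. a \<le> K"
  proof -
    have "finite (insert N u)" using G u by (auto simp: Fpow_def)
    then show thesis using that[of "Max (insert N u)"] Max_ge by blast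
  qed
  define V where "V = (\<Pi>\<^sub>E i\<in>Pos. if i \<in> {1..K} then {i \<in> u} else UNIV)"
  have "{i. (if i \<in> {1..K} then {i \<in> u} else UNIV) \<noteq> (UNIV :: bool set)} \<subseteq> {1..K}"
    by auto
  then have "openin cantor_top V"
    unfolding V_def cantor_top_def
    by (intro product_topology_basis) (auto intro: finite_subset)
  then have "openin (family_top G) (char_fun -` V \<inter> G)"
    unfolding family_top_def openin_pullback_topology by blast
  moreover have "u \<in> char_fun -` V \<inter> G"
    using u by (auto simp: V_def char_fun_def)
  moreover have "char_fun -` V \<inter> G \<subseteq> end_extensions G u {N<..}"
  proof
    fix v assume v: "v \<in> char_fun -` V \<inter> G"
    have agree: "i \<in> v \<longleftrightarrow> i \<in> u" if "i \<in> {1..K}" for i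
    proof -
      have "char_fun v \<in> V" and "i \<in> Pos" using v that by auto
      then have "char_fun v i \<in> (if i \<in> {1..K} then {i \<in> u} else UNIV)"
        unfolding V_def by (rule PiE_mem)
      then show ?thesis using that by (simp add: char_fun_def)
    qed
    have pos: "u \<subseteq> Pos" "v \<subseteq> Pos" using G u v by (auto simp: Fpow_def)
    have "u \<subseteq> v" using agree K(2) pos by (meson atLeastAtMost_iff atLeast_iff subsetD subsetI)
    moreover have "K < b" if "b \<in> v - u" for b
      using agree[of b] that pos by (cases "b \<le> K") auto
    ultimately show "v \<in> end_extensions G u {N<..}"
      using v K by (fastforce simp: end_extensions_def initial_segment_def)
  qed
  ultimately show ?thesis by blast
qed

section \<open>Subordinated restrictions of F-sequences\<close>

lemma hat_closed_initial_segment: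
  assumes v: "v \<in> hat F \<restriction> M" and uv: "u \<sqsubseteq> v"
  shows "u \<in> hat F \<restriction> M"
proof -
  obtain s where s: "s \<in> F" "v \<sqsubseteq> s"
    using v by (auto simp: hat_def restr_family_def)
  have "u \<sqsubseteq> s" using initial_segment_trans[OF uv s(2)] .
  moreover have "u \<subseteq> v" using uv by (simp add: initial_segment_def)
  moreover have "v \<in> Fpow Pos" "v \<in> Fpow M"
    using v by (auto simp: hat_def restr_family_def)
  ultimately show ?thesis
    using s(1) unfolding hat_def restr_family_def Fpow_def
    by (auto intro: finite_subset)
qed

lemma (in Metric_space) limit_extension_continuous:
  assumes \<phi>: "limit_extension (hat F \<restriction> B) S x {} A \<phi>" and "A \<subseteq> B"
  shows "continuous_map (family_top (hat F \<restriction> A)) mtopology \<phi>"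
  unfolding continuous_map_to_metric
proof (intro ballI allI impI)
  fix u and e :: real assume "u \<in> topspace (family_top (hat F \<restriction> A))" and "e > 0"
  then have u: "u \<in> hat F \<restriction> A"
    by (simp add: family_top_def topspace_pullback_topology)
  have in_ext: "v \<in> end_extensions (hat F \<restriction> B) {} A" if "v \<in> hat F \<restriction> A" for v
    using that \<open>A \<subseteq> B\<close> by (auto simp: end_extensions_def restr_family_def Fpow_def initial_segment_def)
  have "\<exists>N. \<forall>v \<in> end_extensions (hat F \<restriction> B) u (A \<inter> {N<..}). d (\<phi> u) (\<phi> v) < e"
    using \<phi> in_ext[OF u] \<open>e > 0\<close> unfolding limit_extension_def by blast
  then obtain N where N: "\<forall>v \<in> end_extensions (hat F \<restriction> B) u (A \<inter> {N<..}). d (\<phi> u) (\<phi> v) < e" ..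
  have "hat F \<restriction> A \<subseteq> Fpow Pos" by (auto simp: restr_family_def hat_def)
  then obtain U where U: "openin (family_top (hat F \<restriction> A)) U" "u \<in> U" "U \<subseteq> end_extensions (hat F \<restriction> A) u {N<..}"
    using family_top_neighbourhood[OF _ u] by blast
  have "\<phi> v \<in> mball (\<phi> u) e" if "v \<in> U" for v
  proof -
    have v: "v \<in> end_extensions (hat F \<restriction> A) u {N<..}" using U(3) that ..
    then have vA: "v \<in> hat F \<restriction> A" by (simp add: end_extensions_def)
    have "v \<in> end_extensions (hat F \<restriction> B) u (A \<inter> {N<..})"
      using v \<open>A \<subseteq> B\<close> by (auto simp: end_extensions_def restr_family_def Fpow_def)
    then show ?thesis
      using N \<phi> in_ext[OF u] in_ext[OF vA] unfolding limit_extension_def by (auto simp: in_mball)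
  qed
  then show "\<exists>U. openin (family_top (hat F \<restriction> A)) U \<and> u \<in> U \<and> (\<forall>y\<in>U. \<phi> y \<in> mball (\<phi> u) e)"
    using U by blast
qed

lemma thin_maximal_in_hat:
  assumes "thin F" "s \<in> F" "v \<in> hat F" "s \<sqsubseteq> v"
  shows "v = s"
proof -
  obtain r where r: "r \<in> F" "v \<sqsubseteq> r" using assms(3) by (auto simp: hat_def)
  have "s \<sqsubseteq> r" using initial_segment_trans[OF assms(4) r(2)] .
  then have "r = s" using assms(1,2) r(1) unfolding thin_def by blast
  then show ?thesis using assms(4) r(2) unfolding initial_segment_def by blast
qed

theorem theorem5p10:
  fixes T :: "'a topology" and F :: "nat set set" and x :: "nat set \<Rightarrow> 'a" and M :: "nat set"
  assumes "regular_thin F"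
    and "x \<in> F \<rightarrow> topspace T"
    and "M \<subseteq> Pos" and "infinite M"
    and "compact_space (subtopology T (T closure_of (x ` (F \<restriction> M))))"
    and "metrizable_space (subtopology T (T closure_of (x ` (F \<restriction> M))))"
  shows "\<exists>L. L \<subseteq> M \<and> infinite L \<and> subordinated T F L x"
proof -
  let ?S = "F \<restriction> M" and ?G = "hat F \<restriction> M"
  let ?K = "T closure_of (x ` ?S)"
  have F: "F \<subseteq> Fpow Pos" "thin F" "compact_family (hat F)" "hat F \<noteq> {}" "hat F \<subseteq> Fpow Pos"
    using assms(1) by (auto simp: regular_thin_def regular_family_def)
  have xS: "x s \<in> ?K" if "s \<in> ?S" for s
  proof -
    have "x ` ?S \<subseteq> topspace T" using assms(2) by (auto simp: restr_family_def)
    then show ?thesis using closure_of_subset that by blast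
  qed
  show ?thesis
  \<comment> \<open>With \<open>?S\<close> empty the closure has no points to map to, but any constant map into \<open>T\<close> will do.\<close>
  proof (cases "?S = {}")
    case True
    obtain s where "s \<in> F" using F(4) by (auto simp: hat_def)
    then have "continuous_map (family_top (hat F \<restriction> M)) T (\<lambda>_. x s)"
      using assms(2) by auto
    then show ?thesis
      using True assms(4) unfolding subordinated_def by blast
  next
    case False
    obtain M' d where md: "Metric_space M' d" "subtopology T ?K = Metric_space.mtopology M' d"
      using assms(6) unfolding metrizable_space_def by blast
    interpret Metric_space M' d by (rule md)
    have K: "?K = M'"
      using md(2) closure_of_subset_topspace[of T "x ` ?S"]
      by (metis topspace_mtopology topspace_subtopology_subset)
    have "{} \<in> ?G"
      using F(4) by (auto simp: hat_def restr_family_def Fpow_def initial_segment_def)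
    have "\<exists>L\<subseteq>M. infinite L \<and> (\<exists>\<phi>. limit_extension ?G ?S x {} L \<phi>)"
    proof (rule limit_extension_exists)
      show "compact_space mtopology" using assms(5) md(2) by simp
      show "M' \<noteq> {}" using False xS K by blast
      show "wf {(v, u). u \<in> ?G \<and> v \<in> ?G \<and> u \<sqsubseteq> v \<and> u \<noteq> v}"
        using compact_family_wf[OF F(3,5)] by (rule wf_subset) (auto simp: restr_family_def)
      show "v = s" if "s \<in> ?S" "v \<in> ?G" "s \<sqsubseteq> v" for s v
        using thin_maximal_in_hat[OF F(2)] that by (auto simp: restr_family_def)
      show "u \<in> ?G" if "v \<in> ?G" "u \<sqsubseteq> v" for u v
        using that by (rule hat_closed_initial_segment)
      show "finite v" if "v \<in> ?G" for v
        using that by (simp add: restr_family_def Fpow_def)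
      show "x s \<in> M'" if "s \<in> ?S" for s
        using xS[OF that] K by simp
    qed (use \<open>{} \<in> ?G\<close> assms(4) in simp_all)
    then obtain L \<phi> where L: "L \<subseteq> M" "infinite L" and \<phi>: "limit_extension ?G ?S x {} L \<phi>" by blast
    have "continuous_map (family_top (hat F \<restriction> L)) T \<phi>"
      using limit_extension_continuous[OF \<phi> L(1)] md(2) continuous_map_into_fulltopology by metis
    moreover have "\<phi> s = x s" if s: "s \<in> F \<restriction> L" for s
    proof -
      have "s \<in> ?S" "s \<in> end_extensions ?G {} L"
        using s L(1) F(1)
        by (auto simp: end_extensions_def restr_family_def hat_def Fpow_def initial_segment_def)
      then show ?thesis using \<phi> unfolding limit_extension_def by blast
    qed
    ultimately show ?thesis using L unfolding subordinated_def by blast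
  qed
qed

end
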